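(* Let $F:\mathbb{R}^m\to\mathbb{R}^m$ be continuously differentiable. Then: (a) If $z^*\in\mathbb{R}^m$, $\eta>0$ and $r>0$ are such that $$\langle F(x)-F(z^* ),x-z^*\rangle\ge\eta\|x-z^*\|^2\qquad\text{for all }x\in B(z^*,r),$$ then $$\lambda_{\min}\left(\frac{\nabla F(z^* )+\nabla F(z^* )^\top}{2}\right)\ge\eta>0.$$ (b) If $\lambda_{\min}\left(\frac{\nabla F(z^* )+\nabla F(z^* )^\top}{2}\right)\ge\nu>0$ at some $z^*\in\mathbb{R}^m$, then there is $r>0$ such that $$\langle F(x)-F(z^* ),x-z^*\rangle\ge\frac{\nu}{2}\|x-z^*\|^2\qquad\text{for all }x\in B(z^*,r).$$
   Context: $B(z^*,r)$ is the open Euclidean ball centered at $z^*$ with radius $r$; $\nabla F(z)$ is the Jacobian matrix of $F$ at $z$; $\lambda_{\min}(A)$ is the smallest eigenvalue of a symmetric matrix $A$. *)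

theory Defs
  imports "HOL-Analysis.Analysis"
begin

definition eigenvalues :: "real ^ 'n ^ 'n \<Rightarrow> real set" where
  "eigenvalues A = {c. \<exists>v. v \<noteq> 0 \<and> A *v v = c *\<^sub>R v}"

(* Only meaningful when A has a real eigenvalue, for example when A is symmetric:
   eigenvalues A is always finite, but Min {} is unspecified. *)
definition lambda_min :: "real ^ 'n ^ 'n \<Rightarrow> real" where
  "lambda_min A = Min (eigenvalues A)"

definition sym_part :: "real ^ 'n ^ 'n \<Rightarrow> real ^ 'n ^ 'n" where
  "sym_part A = (1 / 2) *\<^sub>R (A + transpose A)"

lemma transpose_sym_part: "transpose (sym_part A) = sym_part A"
  by (simp add: sym_part_def transpose_def vec_eq_iff add.commute)

definition continuously_differentiable :: "(real ^ 'n \<Rightarrow> real ^ 'n) \<Rightarrow> bool" where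
  "continuously_differentiable F \<longleftrightarrow>
     (\<forall>x. F differentiable (at x)) \<and> continuous_on UNIV (\<lambda>x. jacobian F (at x))"

end

theory Submission
  imports Defs
begin

text \<open>
  The minimum of the Rayleigh quotient of a symmetric matrix over the unit sphere is attained at an
  eigenvector, so it equals the smallest eigenvalue. Differentiability of \<open>F\<close> at \<open>z\<close> makes
  \<open>(F x - F z) \<bullet> (x - z)\<close> agree with the quadratic form of the Jacobian up to
  \<open>\<epsilon> * norm (x - z)^2\<close> near \<open>z\<close>, and this quadratic form only sees the symmetric part.
\<close>

lemma symmetric_inner_matrix_vector:
  fixes A :: "real ^ 'n ^ 'n"
  assumes "transpose A = A"
  shows "x \<bullet> (A *v y) = y \<bullet> (A *v x)"
  by (metis assms dot_lmul_matrix inner_commute transpose_matrix_vector)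

lemma inner_sym_part:
  fixes A :: "real ^ 'n ^ 'n"
  shows "x \<bullet> (sym_part A *v x) = x \<bullet> (A *v x)"
proof -
  have "x \<bullet> (transpose A *v x) = x \<bullet> (A *v x)"
    by (metis dot_lmul_matrix inner_commute transpose_matrix_vector)
  then show ?thesis
    by (simp add: sym_part_def scaleR_matrix_vector_assoc[symmetric]
        matrix_vector_mult_add_rdistrib inner_add_right)
qed

text \<open>Choose one eigenvector \<open>e c\<close> for each eigenvalue \<open>c\<close>.
  Evaluating \<open>e d \<bullet> (A *v e c)\<close> in two ways by symmetry shows that eigenvectors
  for distinct eigenvalues are orthogonal, so the chosen ones are distinct and linearly independent,
  hence finitely many. This makes the \<open>Min\<close> in \<open>lambda_min\<close>
  usable.\<close>

lemma finite_eigenvalues_symmetric: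
  fixes A :: "real ^ 'n ^ 'n"
  assumes sym: "transpose A = A"
  shows "finite (eigenvalues A)"
proof -
  obtain e where e: "\<And>c. c \<in> eigenvalues A \<Longrightarrow> e c \<noteq> 0 \<and> A *v e c = c *\<^sub>R e c"
    using bchoice[of "eigenvalues A" "\<lambda>c v. v \<noteq> 0 \<and> A *v v = c *\<^sub>R v"]
    unfolding eigenvalues_def by blast
  have orth: "e c \<bullet> e d = 0" if "c \<in> eigenvalues A" "d \<in> eigenvalues A" "c \<noteq> d" for c d
  proof -
    have "c * (e c \<bullet> e d) = d * (e c \<bullet> e d)"
      using symmetric_inner_matrix_vector[OF sym, of "e d" "e c"] e[OF that(1)] e[OF that(2)]
      by (simp add: inner_commute)
    then show ?thesis
      using \<open>c \<noteq> d\<close> by simp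
  qed
  have inj: "inj_on e (eigenvalues A)"
    by (rule inj_onI) (metis e orth inner_eq_zero_iff)
  have "pairwise orthogonal (e ` eigenvalues A)"
    unfolding pairwise_def orthogonal_def using orth by auto
  moreover have "0 \<notin> e ` eigenvalues A"
    using e by auto
  ultimately have "independent (e ` eigenvalues A)"
    by (rule pairwise_orthogonal_independent)
  then show ?thesis
    using inj finite_imageD independent_imp_finite by blast
qed

text \<open>First-variation argument: the form
  \<open>x \<bullet> (A *v x) - c * (x \<bullet> x)\<close> is nonnegative and vanishes at
  \<open>v\<close>. Its derivative at \<open>v\<close> along the residual \<open>w\<close> is
  \<open>2 * p\<close>, twice the squared norm of \<open>w\<close>, so a nonzero residual would make
  the form negative at a point slightly off \<open>v\<close>.\<close>

lemma Rayleigh_minimizer_eigenvector: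
  fixes A :: "real ^ 'n ^ 'n"
  assumes sym: "transpose A = A"
    and nonneg: "\<And>x. c * (x \<bullet> x) \<le> x \<bullet> (A *v x)"
    and eq: "v \<bullet> (A *v v) = c * (v \<bullet> v)"
  shows "A *v v = c *\<^sub>R v"
proof -
  define w where "w = A *v v - c *\<^sub>R v"
  define p where "p = w \<bullet> w"
  define q where "q = w \<bullet> (A *v w) - c * (w \<bullet> w)"
  \<comment> \<open>For \<open>q > 0\<close> the quadratic \<open>2 * t * p + t\<^sup>2 * q\<close>
    is minimal at \<open>- p / q\<close>; the shifted denominator also covers \<open>q = 0\<close>
    and still gives a negative value unless \<open>p = 0\<close>.\<close>
  define t where "t = - p / (q + 1)"
  have q: "q \<ge> 0"
    using nonneg[of w] by (simp add: q_def)
  have p: "p = w \<bullet> (A *v v) - c * (w \<bullet> v)"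
    by (simp add: p_def w_def inner_diff_right)
  \<comment> \<open>The constant term cancels by \<open>eq\<close>, and symmetry merges the two
    cross terms into \<open>2 * t * p\<close>.\<close>
  have "(v + t *\<^sub>R w) \<bullet> (A *v (v + t *\<^sub>R w)) - c * ((v + t *\<^sub>R w) \<bullet> (v + t *\<^sub>R w))
      = 2 * t * p + t\<^sup>2 * q"
    unfolding p q_def matrix_vector_right_distrib matrix_vector_mult_scaleR inner_add_left
      inner_add_right inner_scaleR_left inner_scaleR_right inner_commute[of v w]
      symmetric_inner_matrix_vector[OF sym, of v w] eq
    by (simp add: power2_eq_square algebra_simps)
  then have "0 \<le> 2 * t * p + t\<^sup>2 * q"
    using nonneg[of "v + t *\<^sub>R w"] by simp
  also have "\<dots> = - (p\<^sup>2 * (q + 2)) / (q + 1)\<^sup>2"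
    using q by (simp add: t_def power2_eq_square divide_simps) (simp add: algebra_simps)
  finally have "p\<^sup>2 * (q + 2) \<le> 0"
    using q by (simp add: zero_le_divide_iff divide_simps split: if_splits)
  then have "p = 0"
    using q by (simp add: mult_le_0_iff)
  then show ?thesis
    by (simp add: p_def w_def)
qed

lemma lambda_min_symmetric:
  fixes A :: "real ^ 'n ^ 'n"
  assumes sym: "transpose A = A"
  shows lambda_min_in_eigenvalues: "lambda_min A \<in> eigenvalues A"
    and lambda_min_le_Rayleigh: "lambda_min A * (norm x)\<^sup>2 \<le> x \<bullet> (A *v x)"
proof -
  have "continuous_on (sphere 0 1) (\<lambda>x. x \<bullet> (A *v x))"
    by (intro continuous_intros linear_continuous_on matrix_vector_mul_bounded_linear)
  moreover have "sphere (0 :: real ^ 'n) 1 \<noteq> {}"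
    by simp
  ultimately obtain v where v: "v \<in> sphere 0 1"
    and v_min: "\<And>x. x \<in> sphere 0 1 \<Longrightarrow> v \<bullet> (A *v v) \<le> x \<bullet> (A *v x)"
    using continuous_attains_inf[OF compact_sphere, of 0 1 "\<lambda>x. x \<bullet> (A *v x)"] by blast
  define c where "c = v \<bullet> (A *v v)"
  \<comment> \<open>Both sides are homogeneous of degree two, so the bound on the unit sphere
    extends to every vector.\<close>
  have bound: "c * (y \<bullet> y) \<le> y \<bullet> (A *v y)" for y
  proof (cases "y = 0")
    case False
    define u where "u = (1 / norm y) *\<^sub>R y"
    have "c \<le> u \<bullet> (A *v u)"
      using False v_min[of u] by (simp add: c_def u_def)
    moreover have "y = norm y *\<^sub>R u"
      using False by (simp add: u_def)
    then have "y \<bullet> (A *v y) = (norm y)\<^sup>2 * (u \<bullet> (A *v u))"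
      by (metis inner_scaleR_left inner_scaleR_right matrix_vector_mult_scaleR mult.assoc
          power2_eq_square)
    ultimately show ?thesis
      by (simp add: power2_norm_eq_inner[symmetric] mult.commute[of "(norm y)\<^sup>2"] mult_right_mono)
  qed simp
  have "v \<bullet> v = 1"
    using v by (simp add: power2_norm_eq_inner[symmetric])
  then have "A *v v = c *\<^sub>R v"
    using Rayleigh_minimizer_eigenvector[OF sym bound, of v] by (simp add: c_def)
  then have c: "c \<in> eigenvalues A"
    using \<open>v \<bullet> v = 1\<close> unfolding eigenvalues_def by (intro CollectI exI[of _ v]) auto
  \<comment> \<open>At an eigenvector the Rayleigh quotient equals the eigenvalue, so
    \<open>bound\<close> applies to it directly.\<close>
  have "c \<le> d" if d: "d \<in> eigenvalues A" for d
  proof -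
    obtain u where u: "u \<noteq> 0" "A *v u = d *\<^sub>R u"
      using d unfolding eigenvalues_def by blast
    have "c * (u \<bullet> u) \<le> d * (u \<bullet> u)"
      using bound[of u] by (simp add: u(2))
    moreover have "u \<bullet> u > 0"
      using u(1) by simp
    ultimately show ?thesis
      by (rule mult_right_le_imp_le)
  qed
  then have "lambda_min A = c"
    unfolding lambda_min_def
    using c finite_eigenvalues_symmetric[OF sym] by (intro Min_eqI) auto
  then show "lambda_min A \<in> eigenvalues A" "lambda_min A * (norm x)\<^sup>2 \<le> x \<bullet> (A *v x)"
    using c bound[of x] by (auto simp: power2_norm_eq_inner)
qed

text \<open>The first-order Taylor remainder is paired with \<open>x - z\<close> and estimated by
  Cauchy-Schwarz. Part (a) uses this with arbitrarily small \<epsilon>, part (b) with half of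
  \<nu>.\<close>

lemma inner_increment_approx:
  fixes F :: "real ^ 'n \<Rightarrow> real ^ 'n"
  assumes "F differentiable (at z)" and "\<epsilon> > 0"
  obtains d where "d > 0"
    and "\<And>x. x \<in> ball z d \<Longrightarrow>
      \<bar>(F x - F z) \<bullet> (x - z) - (x - z) \<bullet> (jacobian F (at z) *v (x - z))\<bar> \<le> \<epsilon> * (norm (x - z))\<^sup>2"
proof -
  let ?J = "jacobian F (at z)"
  have "(F has_derivative (\<lambda>h. ?J *v h)) (at z)"
    using assms(1) jacobian_works by blast
  then obtain d where "d > 0"
    and d: "\<And>x. norm (x - z) < d \<Longrightarrow> norm (F x - F z - ?J *v (x - z)) \<le> \<epsilon> * norm (x - z)"
    unfolding has_derivative_at_alt using \<open>\<epsilon> > 0\<close> by blast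
  show ?thesis
  proof (rule that[OF \<open>d > 0\<close>])
    fix x assume "x \<in> ball z d"
    then have "norm (F x - F z - ?J *v (x - z)) \<le> \<epsilon> * norm (x - z)"
      by (intro d) (simp add: dist_norm norm_minus_commute)
    then have "norm (F x - F z - ?J *v (x - z)) * norm (x - z) \<le> \<epsilon> * norm (x - z) * norm (x - z)"
      by (rule mult_right_mono) simp
    then have "norm (F x - F z - ?J *v (x - z)) * norm (x - z) \<le> \<epsilon> * (norm (x - z))\<^sup>2"
      by (simp add: power2_eq_square mult.assoc)
    moreover have "(F x - F z) \<bullet> (x - z) - (x - z) \<bullet> (?J *v (x - z))
        = (F x - F z - ?J *v (x - z)) \<bullet> (x - z)"
      by (metis inner_commute inner_diff_left)
    ultimately show "\<bar>(F x - F z) \<bullet> (x - z) - (x - z) \<bullet> (?J *v (x - z))\<bar>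
        \<le> \<epsilon> * (norm (x - z))\<^sup>2"
      using Cauchy_Schwarz_ineq2 order_trans by metis
  qed
qed

text \<open>Approach \<open>z\<close> along the direction \<open>v\<close>. At
  \<open>x = z + t *\<^sub>R v\<close> the lower bound, the quadratic form and the error all scale
  by \<open>t\<^sup>2\<close>, so this factor cancels and only \<epsilon> is left to tend to
  zero.\<close>

lemma jacobian_form_ge:
  fixes F :: "real ^ 'n \<Rightarrow> real ^ 'n"
  assumes diff: "F differentiable (at z)" and "r > 0"
    and mono: "\<And>x. x \<in> ball z r \<Longrightarrow> (F x - F z) \<bullet> (x - z) \<ge> \<eta> * (norm (x - z))\<^sup>2"
  shows "v \<bullet> (jacobian F (at z) *v v) \<ge> \<eta> * (norm v)\<^sup>2"
proof (cases "v = 0")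
  case False
  let ?J = "jacobian F (at z)"
  have approx: "\<eta> - \<epsilon> \<le> (v \<bullet> (?J *v v)) / (norm v)\<^sup>2" if \<epsilon>: "\<epsilon> > 0" for \<epsilon>
  proof -
    obtain d where "d > 0" and d: "\<And>x. x \<in> ball z d \<Longrightarrow>
      \<bar>(F x - F z) \<bullet> (x - z) - (x - z) \<bullet> (?J *v (x - z))\<bar> \<le> \<epsilon> * (norm (x - z))\<^sup>2"
      using inner_increment_approx[OF diff \<epsilon>] by blast
    \<comment> \<open>The factor 2 puts \<open>x\<close> strictly inside both open balls.\<close>
    define t where "t = min d r / (2 * norm v)"
    define x where "x = z + t *\<^sub>R v"
    have "t > 0"
      using \<open>d > 0\<close> \<open>r > 0\<close> False by (simp add: t_def)
    have "norm (x - z) = min d r / 2"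
      using \<open>d > 0\<close> \<open>r > 0\<close> False by (simp add: x_def t_def)
    then have "x \<in> ball z d" "x \<in> ball z r"
      using \<open>d > 0\<close> \<open>r > 0\<close> by (auto simp: dist_norm norm_minus_commute)
    then have "(\<eta> - \<epsilon>) * (norm (x - z))\<^sup>2 \<le> (x - z) \<bullet> (?J *v (x - z))"
      using d[of x] mono[of x] by (simp add: left_diff_distrib)
    then have "t\<^sup>2 * ((\<eta> - \<epsilon>) * (norm v)\<^sup>2) \<le> t\<^sup>2 * (v \<bullet> (?J *v v))"
      by (simp add: x_def matrix_vector_mult_scaleR power_mult_distrib power2_eq_square
          algebra_simps)
    then have "(\<eta> - \<epsilon>) * (norm v)\<^sup>2 \<le> v \<bullet> (?J *v v)"
      using \<open>t > 0\<close> by simp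
    then show ?thesis
      using False by (simp add: pos_le_divide_eq)
  qed
  \<comment> \<open>Dividing by \<open>(norm v)\<^sup>2\<close> has left the error as a bare
    \<epsilon>, the shape that \<open>field_le_epsilon\<close> expects.\<close>
  have "\<eta> \<le> (v \<bullet> (?J *v v)) / (norm v)\<^sup>2"
    by (rule field_le_epsilon) (use approx in force)
  then show ?thesis
    using False by (simp add: pos_le_divide_eq)
qed simp

theorem theorem6:
  fixes F :: "real ^ 'm \<Rightarrow> real ^ 'm"
  assumes "continuously_differentiable F"
  shows "(\<forall>z \<eta> r. \<eta> > 0 \<and> r > 0 \<and>
            (\<forall>x \<in> ball z r. (F x - F z) \<bullet> (x - z) \<ge> \<eta> * (norm (x - z))\<^sup>2)
            \<longrightarrow> lambda_min (sym_part (jacobian F (at z))) \<ge> \<eta> \<and> \<eta> > 0) \<and>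
         (\<forall>z \<nu>. lambda_min (sym_part (jacobian F (at z))) \<ge> \<nu> \<and> \<nu> > 0
            \<longrightarrow> (\<exists>r > 0. \<forall>x \<in> ball z r.
                   (F x - F z) \<bullet> (x - z) \<ge> \<nu> / 2 * (norm (x - z))\<^sup>2))"
proof (intro conjI allI impI; elim conjE)
  fix z :: "real ^ 'm" and \<eta> r :: real
  assume "r > 0" and mono: "\<forall>x \<in> ball z r. (F x - F z) \<bullet> (x - z) \<ge> \<eta> * (norm (x - z))\<^sup>2"
  let ?S = "sym_part (jacobian F (at z))"
  \<comment> \<open>Testing the form bound at an eigenvector for \<open>lambda_min ?S\<close> turns
    it into an inequality between \<eta> and that eigenvalue.\<close>
  obtain v where v: "v \<noteq> 0" "?S *v v = lambda_min ?S *\<^sub>R v"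
    using lambda_min_in_eigenvalues[OF transpose_sym_part] unfolding eigenvalues_def by blast
  have "F differentiable (at z)"
    using assms by (simp add: continuously_differentiable_def)
  then have "\<eta> * (norm v)\<^sup>2 \<le> v \<bullet> (?S *v v)"
    using jacobian_form_ge[of F z r \<eta> v] \<open>r > 0\<close> mono by (simp add: inner_sym_part)
  then show "lambda_min ?S \<ge> \<eta>"
    using v by (simp add: power2_norm_eq_inner)
next
  fix z :: "real ^ 'm" and \<nu> :: real
  let ?J = "jacobian F (at z)"
  assume lam: "lambda_min (sym_part ?J) \<ge> \<nu>" and "\<nu> > 0"
  have "F differentiable (at z)"
    using assms by (simp add: continuously_differentiable_def)
  \<comment> \<open>The quadratic form is at least \<nu> times the squared norm; spending half of
    \<nu> on the error leaves the other half.\<close>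
  then obtain d where "d > 0" and d: "\<And>x. x \<in> ball z d \<Longrightarrow>
      \<bar>(F x - F z) \<bullet> (x - z) - (x - z) \<bullet> (?J *v (x - z))\<bar> \<le> \<nu> / 2 * (norm (x - z))\<^sup>2"
    using inner_increment_approx[of F z "\<nu> / 2"] \<open>\<nu> > 0\<close> by (metis half_gt_zero)
  have "(F x - F z) \<bullet> (x - z) \<ge> \<nu> / 2 * (norm (x - z))\<^sup>2" if "x \<in> ball z d" for x
  proof -
    have "\<nu> * (norm (x - z))\<^sup>2 \<le> lambda_min (sym_part ?J) * (norm (x - z))\<^sup>2"
      using lam by (intro mult_right_mono) auto
    also have "\<dots> \<le> (x - z) \<bullet> (?J *v (x - z))"
      using lambda_min_le_Rayleigh[OF transpose_sym_part] by (metis inner_sym_part)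
    finally show ?thesis
      using d[OF that] by linarith
  qed
  with \<open>d > 0\<close> show "\<exists>r > 0. \<forall>x \<in> ball z r. (F x - F z) \<bullet> (x - z) \<ge> \<nu> / 2 * (norm (x - z))\<^sup>2"
    by blast
qed

end
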